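(* Let $\mathcal{D}$ be a design in the indeterminates $x_1,\dots,x_r$ and let $\alpha=(\alpha_1,\dots,\alpha_r)\in\mathbb{Z}_{\ge 0}^r$. A necessary condition for the monomial $\alpha$ to be included in a hierarchical identifiable (HI) model supported by $\mathcal{D}$ is that $$\prod_{i:\,x_i\in U}(\alpha_i+1)\le n_U$$ for every subset $U$ of the indeterminates $\{x_1,\dots,x_r\}$.
   Context: A design $\mathcal{D}$ is a set of $n>1$ distinct points in $\mathbb{R}^r$, with coordinates (indeterminates) $x_1,\dots,x_r$, such that $x_j$ takes $n_j>1$ distinct values over the points of $\mathcal{D}$, for $j=1,\dots,r$. Let $(x_{i1},\dots,x_{ir})$ denote the $i$th point, $i=1,\dots,n$. For a subset $U$ of the indeterminates, $n_U$ denotes the number of distinct rows remaining when the columns of the $n\times r$ design matrix $(x_{ij})$ corresponding to indeterminates not in $U$ are deleted, i.e. the number of distinct points obtained by projecting $\mathcal{D}$ onto the coordinates in $U$ (so $n_U=n$ if $U$ is the full set of indeterminates). A monomial is $x^\alpha = x_1^{\alpha_1}\cdots x_r^{\alpha_r}$ with $\alpha\in\mathbb{Z}_{\ge 0}^r$; it is identified with the $r$-tuple $\alpha$. The monomial vector $\mathbf{x}^\alpha\in\mathbb{R}^n$ of $\alpha$ has $i$th entry $\prod_{j=1}^r x_{ij}^{\alpha_j}$ (with $0^0=1$). A (polynomial) model with $p$ terms is $E[Y]=\sum_{k=1}^p \theta_{\alpha_k}x^{\alpha_k}$ with $\alpha_1,\dots,\alpha_p$ distinct monomials and unknown coefficients;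 it is determined by its set of monomials. It is identifiable from (supported by) $\mathcal{D}$ if the $n\times p$ model matrix with columns $\mathbf{x}^{\alpha_1},\dots,\mathbf{x}^{\alpha_p}$ has rank $p$. A model is hierarchical if for every monomial $\alpha$ in the model, every $\beta\in\mathbb{Z}_{\ge 0}^r$ with $\beta_j\le\alpha_j$ for all $j$ is also in the model. A HI model is one that is hierarchical and identifiable. *)

theory Defs
  imports "HOL-Analysis.Analysis" "Jordan_Normal_Form.DL_Rank"
begin

text \<open>Jordan\_Normal\_Form reuses the infix for component access in \<open>real ^ 'r\<close>; here it
  always denotes the latter.\<close>

no_notation vec_index (infixl "$" 100)

text \<open>The indeterminates \<open>x\<^sub>1, \<dots>, x\<^sub>r\<close> are indexed by the finite type \<open>'r\<close>, and the monomial
  \<open>x\<^sup>\<alpha>\<close> is identified with its exponent vector \<open>\<alpha> :: nat ^ 'r\<close>.\<close>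

definition is_design :: "(real ^ 'r) set \<Rightarrow> bool" where
  "is_design D \<longleftrightarrow> finite D \<and> card D > 1 \<and> (\<forall>j. card ((\<lambda>x. x $ j) ` D) > 1)"

text \<open>The number \<open>n\<^sub>U\<close> of distinct rows left after deleting from the design matrix the columns
  of the indeterminates outside \<open>U\<close>; \<open>restrict\<close> forgets those coordinates.\<close>

definition num_proj :: "(real ^ 'r) set \<Rightarrow> 'r set \<Rightarrow> nat" where
  "num_proj D U = card ((\<lambda>x. restrict (\<lambda>j. x $ j) U) ` D)"

definition monom_eval :: "nat ^ 'r \<Rightarrow> real ^ 'r \<Rightarrow> real" where
  "monom_eval \<alpha> x = (\<Prod>j\<in>UNIV. x $ j ^ \<alpha> $ j)"

definition model_matrix :: "(real ^ 'r) list \<Rightarrow> (nat ^ 'r) list \<Rightarrow> real mat" where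
  "model_matrix xs as =
     mat (length xs) (length as) (\<lambda>(i, k). monom_eval (as ! k) (xs ! i))"

text \<open>Designs and models are sets, so the model matrix is formed from listings of the points and
  of the monomials without repetition. Its rank does not depend on the listings, which only permute
  rows and columns. The condition forces the model to be finite.\<close>

definition identifiable :: "(real ^ 'r) set \<Rightarrow> (nat ^ 'r) set \<Rightarrow> bool" where
  "identifiable D M \<longleftrightarrow>
     (\<exists>xs as. distinct xs \<and> set xs = D \<and> distinct as \<and> set as = M \<and>
        vec_space.rank (length xs) (model_matrix xs as) = length as)"

definition hierarchical :: "(nat ^ 'r) set \<Rightarrow> bool" where
  "hierarchical M \<longleftrightarrow> (\<forall>\<alpha>\<in>M. \<forall>\<beta>. (\<forall>j. \<beta> $ j \<le> \<alpha> $ j) \<longrightarrow> \<beta> \<in> M)"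

definition HI_model :: "(real ^ 'r) set \<Rightarrow> (nat ^ 'r) set \<Rightarrow> bool" where
  "HI_model D M \<longleftrightarrow> hierarchical M \<and> identifiable D M"

lemma num_proj_UNIV: "num_proj D UNIV = card D"
  unfolding num_proj_def by (rule card_image) (auto simp: inj_on_def Finite_Cartesian_Product.vec_eq_iff fun_eq_iff)

end

theory Submission
  imports Defs
begin

text \<open>
  The condition comes from counting dimensions of function spaces. A hierarchical model containing
  \<open>\<alpha>\<close> contains every monomial in the box below \<open>\<alpha>\<close>, in particular the \<open>\<Prod>i\<in>U. \<alpha>\<^sub>i + 1\<close> monomials of
  that box which involve only the indeterminates in \<open>U\<close> (\<open>card_box\<close>). On the design the values of
  these monomials depend only on the projection of a point to the coordinates in \<open>U\<close>
  (\<open>monom_eval_eq_restrict\<close>), so they are functions on a set of \<open>n\<^sub>U\<close> points. Were there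
  more than \<open>n\<^sub>U\<close> of them, a homogeneous system with \<open>n\<^sub>U\<close> equations would give a nontrivial linear
  relation among them (\<open>underdetermined_system_solution\<close>), contradicting the linear independence on
  the design that identifiability provides (\<open>identifiable_imp_independent\<close>).
\<close>

text \<open>Gaussian elimination, one equation at a time: if the equation at \<open>q\<close> has a nonzero
  coefficient at some unknown \<open>b0\<close>, solve it for \<open>b0\<close> and substitute into the other equations.\<close>

lemma underdetermined_system_solution:
  fixes f :: "'b \<Rightarrow> 'p \<Rightarrow> 'a :: field"
  assumes "finite P" "finite B" "card P < card B"
  shows "\<exists>c. (\<exists>b\<in>B. c b \<noteq> 0) \<and> (\<forall>p\<in>P. (\<Sum>b\<in>B. c b * f b p) = 0)"
  using assms
proof (induction P arbitrary: B f rule: finite_induct)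
  case empty
  then have "B \<noteq> {}" by auto
  then show ?case by (intro exI[of _ "\<lambda>_. 1"]) auto
next
  case (insert q P)
  show ?case
  proof (cases "\<forall>b\<in>B. f b q = 0")
    case True
    have "card P < card B" using insert by simp
    then obtain c where "\<exists>b\<in>B. c b \<noteq> 0" "\<forall>p\<in>P. (\<Sum>b\<in>B. c b * f b p) = 0"
      using insert.IH[OF \<open>finite B\<close>] by blast
    then show ?thesis using True by (intro exI[of _ c]) auto
  next
    case False
    then obtain b0 where b0: "b0 \<in> B" "f b0 q \<noteq> 0" by blast
    define B' where "B' = B - {b0}"
    have B': "finite B'" "b0 \<notin> B'" "B = insert b0 B'"
      using insert.prems(1) b0 by (auto simp: B'_def)
    have "card P < card B'" using insert.hyps insert.prems B' by simp
    then obtain c where nz: "\<exists>b\<in>B'. c b \<noteq> 0"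
      and c: "\<forall>p\<in>P. (\<Sum>b\<in>B'. c b * (f b p - f b q / f b0 q * f b0 p)) = 0"
      using insert.IH[OF \<open>finite B'\<close>, of "\<lambda>b p. f b p - f b q / f b0 q * f b0 p"] by blast
    define s where "s = (\<Sum>b\<in>B'. c b * f b q)"
    define d where "d = c(b0 := - s / f b0 q)"
    have sum_d: "(\<Sum>b\<in>B. d b * f b p) = (\<Sum>b\<in>B'. c b * f b p) - s / f b0 q * f b0 p" for p
    proof -
      have "(\<Sum>b\<in>B'. d b * f b p) = (\<Sum>b\<in>B'. c b * f b p)"
        using B'(2) by (intro sum.cong) (auto simp: d_def)
      then show ?thesis using B' by (simp add: d_def)
    qed
    have "(\<Sum>b\<in>B. d b * f b p) = 0" if "p \<in> P" for p
    proof -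
      have "(\<Sum>b\<in>B'. c b * (f b p - f b q / f b0 q * f b0 p))
          = (\<Sum>b\<in>B'. c b * f b p) - s / f b0 q * f b0 p"
        by (simp add: s_def right_diff_distrib sum_subtractf sum_distrib_right sum_divide_distrib
            mult.assoc)
      then show ?thesis using c that sum_d by simp
    qed
    moreover have "(\<Sum>b\<in>B. d b * f b q) = 0"
      using sum_d[of q] b0 by (simp add: s_def)
    moreover have "\<exists>b\<in>B. d b \<noteq> 0" using nz B' by (auto simp: d_def)
    ultimately show ?thesis by blast
  qed
qed

text \<open>Linear independence of a matrix's set of columns ignores repeated columns, so
  \<open>full_rank_lin_indpt\<close> asks for distinct columns. Full column rank forces this, since the rank
  is the size of an independent set of columns.\<close>

lemma (in vec_space) full_rank_distinct_cols:
  assumes "A \<in> carrier_mat n nc" "rank A = nc"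
  shows "distinct (cols A)"
proof -
  let ?P = "\<lambda>T. T \<subseteq> set (cols A) \<and> lin_indpt T"
  have "?P {}" by (simp add: finite_lin_indpt2)
  then obtain S where "maximal S ?P"
    using maximal_exists_superset[of "set (cols A)" ?P "{}"] by blast
  then have "rank A = card S" "S \<subseteq> set (cols A)"
    using rank_card_indpt[OF assms(1)] by (auto simp: maximal_def)
  then have "nc \<le> card (set (cols A))"
    using assms(2) by (metis List.finite_set card_mono)
  then show ?thesis
    using assms(1) card_length[of "cols A"] by (intro card_distinct) auto
qed

lemma (in vec_space) full_rank_trivial_kernel:
  assumes "A \<in> carrier_mat n nc" "rank A = nc"
    and "v \<in> carrier_vec nc" "A *\<^sub>v v = 0\<^sub>v n"
  shows "v = 0\<^sub>v nc"
  using assms full_rank_distinct_cols full_rank_lin_indpt lin_depI by metis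

lemma identifiable_imp_finite: "identifiable D M \<Longrightarrow> finite M"
  by (auto simp: identifiable_def)

lemma identifiable_imp_independent:
  assumes "identifiable D M"
    and zero: "\<And>x. x \<in> D \<Longrightarrow> (\<Sum>\<beta>\<in>M. c \<beta> * monom_eval \<beta> x) = 0"
    and "\<beta> \<in> M"
  shows "c \<beta> = 0"
proof -
  from assms(1) obtain xs as where xs: "set xs = D" and as: "distinct as" "set as = M"
    and rank: "vec_space.rank (length xs) (model_matrix xs as) = length as"
    unfolding identifiable_def by blast
  define v where "v = vec (length as) (\<lambda>k. c (as ! k))"
  have A: "model_matrix xs as \<in> carrier_mat (length xs) (length as)"
    by (simp add: model_matrix_def)
  have "model_matrix xs as *\<^sub>v v = 0\<^sub>v (length xs)"
  proof (rule eq_vecI)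
    fix i assume "i < dim_vec (0\<^sub>v (length xs))"
    then have i: "i < length xs" by simp
    have "vec_index (model_matrix xs as *\<^sub>v v) i
        = (\<Sum>k<length as. c (as ! k) * monom_eval (as ! k) (xs ! i))"
      using i by (simp add: model_matrix_def v_def scalar_prod_def lessThan_atLeast0 mult.commute)
    also have "\<dots> = (\<Sum>\<beta>\<in>M. c \<beta> * monom_eval \<beta> (xs ! i))"
      using bij_betw_nth[OF as(1) refl as(2)[symmetric]]
      by (rule sum.reindex_bij_betw)
    also have "\<dots> = 0" using zero xs i by auto
    finally show "vec_index (model_matrix xs as *\<^sub>v v) i = vec_index (0\<^sub>v (length xs)) i"
      using i by simp
  qed (simp add: model_matrix_def)
  then have "v = 0\<^sub>v (length as)"
    using vec_space.full_rank_trivial_kernel[OF A rank] by (simp add: v_def)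
  moreover obtain k where "k < length as" "as ! k = \<beta>"
    using assms(3) as by (metis in_set_conv_nth)
  ultimately show ?thesis by (metis v_def index_vec index_zero_vec(1))
qed

definition box :: "nat ^ 'r \<Rightarrow> 'r set \<Rightarrow> (nat ^ 'r) set" where
  "box \<alpha> U = {\<beta>. \<forall>j. \<beta> $ j \<le> (if j \<in> U then \<alpha> $ j else 0)}"

lemma card_box: "card (box \<alpha> U) = (\<Prod>i\<in>U. \<alpha> $ i + 1)"
proof -
  let ?F = "PiE UNIV (\<lambda>j. {..if j \<in> U then \<alpha> $ j else 0})"
  have "bij_betw vec_nth (box \<alpha> U) ?F"
    by (rule bij_betwI[where g = vec_lambda]) (auto simp: box_def PiE_def Pi_def)
  then have "card (box \<alpha> U) = card ?F" by (rule bij_betw_same_card)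
  also have "\<dots> = (\<Prod>j\<in>UNIV. if j \<in> U then \<alpha> $ j + 1 else 1)"
    by (subst card_PiE) (auto intro!: prod.cong)
  also have "\<dots> = (\<Prod>i\<in>U. \<alpha> $ i + 1)"
    by (simp add: prod.If_cases)
  finally show ?thesis .
qed

lemma hierarchical_box_subset:
  assumes "hierarchical M" "\<alpha> \<in> M"
  shows "box \<alpha> U \<subseteq> M"
proof
  fix \<beta> assume "\<beta> \<in> box \<alpha> U"
  then have "\<beta> $ j \<le> \<alpha> $ j" for j
    by (auto simp: box_def split: if_splits dest: spec[of _ j])
  then show "\<beta> \<in> M" using assms by (auto simp: hierarchical_def)
qed

lemma monom_eval_eq_restrict:
  assumes "\<beta> \<in> box \<alpha> U"
  shows "monom_eval \<beta> x = (\<Prod>j\<in>U. restrict (\<lambda>j. x $ j) U j ^ \<beta> $ j)"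
proof -
  have "monom_eval \<beta> x = (\<Prod>j\<in>U. x $ j ^ \<beta> $ j)"
    unfolding monom_eval_def
  proof (intro prod.mono_neutral_right ballI)
    fix j assume "j \<in> UNIV - U"
    then have "\<beta> $ j = 0" using assms by (auto simp: box_def dest: spec[of _ j])
    then show "x $ j ^ \<beta> $ j = 1" by simp
  qed auto
  then show ?thesis by simp
qed

theorem theorem4p5:
  fixes D :: "(real ^ 'r) set" and M :: "(nat ^ 'r) set" and \<alpha> :: "nat ^ 'r"
  assumes "is_design D"
    and "HI_model D M"
    and "\<alpha> \<in> M"
  shows "\<forall>U :: 'r set. (\<Prod>i\<in>U. \<alpha> $ i + 1) \<le> num_proj D U"
proof (rule allI, rule ccontr)
  fix U :: "'r set"
  define P where "P = (\<lambda>x. restrict (\<lambda>j. x $ j) U) ` D"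
  define B where "B = box \<alpha> U"
  assume "\<not> (\<Prod>i\<in>U. \<alpha> $ i + 1) \<le> num_proj D U"
  then have "card P < card B"
    by (simp add: P_def B_def num_proj_def card_box)
  moreover have "finite P" using assms(1) by (simp add: P_def is_design_def)
  moreover have M: "identifiable D M" "B \<subseteq> M"
    using assms hierarchical_box_subset by (auto simp: HI_model_def B_def)
  moreover have "finite B" "finite M"
    using M identifiable_imp_finite finite_subset by blast+
  ultimately obtain c where c: "\<exists>\<beta>\<in>B. c \<beta> \<noteq> 0"
    "\<forall>p\<in>P. (\<Sum>\<beta>\<in>B. c \<beta> * (\<Prod>j\<in>U. p j ^ \<beta> $ j)) = 0"
    using underdetermined_system_solution[of P B "\<lambda>\<beta> p. \<Prod>j\<in>U. p j ^ \<beta> $ j"] by blast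
  \<comment> \<open>Extended by zero, \<open>c\<close> is a nontrivial relation among all monomials of the model.\<close>
  define d where "d \<beta> = (if \<beta> \<in> B then c \<beta> else 0)" for \<beta>
  have "(\<Sum>\<beta>\<in>M. d \<beta> * monom_eval \<beta> x) = 0" if "x \<in> D" for x
  proof -
    have "(\<Sum>\<beta>\<in>M. d \<beta> * monom_eval \<beta> x) = (\<Sum>\<beta>\<in>B. d \<beta> * monom_eval \<beta> x)"
      using \<open>finite M\<close> M by (intro sum.mono_neutral_right) (auto simp: d_def)
    also have "\<dots> = (\<Sum>\<beta>\<in>B. c \<beta> * (\<Prod>j\<in>U. restrict (\<lambda>j. x $ j) U j ^ \<beta> $ j))"
      by (intro sum.cong refl) (simp add: d_def B_def monom_eval_eq_restrict)
    also have "\<dots> = 0" using c(2) that by (simp only: P_def ball_simps)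
    finally show ?thesis .
  qed
  then have "d \<beta> = 0" if "\<beta> \<in> M" for \<beta>
    using identifiable_imp_independent[OF M(1)] that by blast
  then show False using c(1) M(2) by (metis d_def subsetD)
qed

end
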